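(* Let $d\ge1$ and let $\{(R_j,B_j)\}_{j\ge1}$ be a sequence of pairs where $R_j$ is an expanding $d\times d$ integer matrix and $B_j\subset\mathbb{Z}^d$ is a finite set whose elements lie in pairwise distinct cosets of $R_j(\mathbb{Z}^d)$ in $\mathbb{Z}^d$. Suppose that the associated measure $$\mu=\delta_{\mathbf{R}_1^{-1}B_1}*\delta_{\mathbf{R}_2^{-1}B_2}*\cdots,\qquad \mathbf{R}_n=R_nR_{n-1}\cdots R_1,$$ satisfies the no-overlap condition. Then $\mu$ admits an exponential Riesz sequence of infinite cardinality; that is, there is an infinite set $\Lambda\subset\mathbb{R}^d$ such that $\{e^{2\pi i\langle\lambda,x\rangle}:\lambda\in\Lambda\}$ is a Riesz sequence for $L^2(\mu)$.
   Context: A square matrix is expanding if all its eigenvalues have modulus $>1$. A collection $\{f_k\}$ in a Hilbert space is a Riesz sequence if there are $C,D>0$ with $C\sum|a_k|^2\le\|\sum a_kf_k\|^2\le D\sum|a_k|^2$ for all finitely supported scalar sequences $(a_k)$. For a finite set $A$, $\delta_A=\frac{1}{\#A}\sum_{a\in A}\delta_a$ ($\delta_a$ the Dirac mass at $a$). The infinite convolution defining $\mu$ is assumed to converge weakly to a Borel probability measure. $\mathbf{B}_n=\mathbf{R}_n\{\sum_{k=1}^n\mathbf{R}_k^{-1}b_k:b_k\in B_k\}$ and $K_n=\{\sum_{k=n+1}^\infty\mathbf{R}_k^{-1}b_k:b_k\in B_k\}$ (these series being assumed to converge). No-overlap condition: $\mu\big((\mathbf{R}_n^{-1}\mathbf{b}+K_n)\cap(\mathbf{R}_n^{-1}\mathbf{b}'+K_n)\big)=0$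 for all $\mathbf{b}\ne\mathbf{b}'$ in $\mathbf{B}_n$ and all $n\ge1$.
   Formalization: The formal theorem assumes every B_j is nonempty and infinitely many B_j have at least two elements; otherwise μ is finitely supported (e.g. all B_j={0} gives δ_0) and has no infinite Riesz sequence. *)

theory Defs
  imports "HOL-Probability.Probability"
begin

text \<open>Sequences \<open>R\<close> of integer matrices and \<open>B\<close> of digit sets are indexed from 1: the values
  \<open>R 0\<close> and \<open>B 0\<close> are never used.\<close>

definition expanding :: "int ^ 'n ^ 'n \<Rightarrow> bool" where
  "expanding A \<longleftrightarrow>
     (\<forall>(z::complex) (v::complex ^ 'n).
        v \<noteq> 0 \<and> map_matrix of_int A *v v = z *s v \<longrightarrow> 1 < cmod z)"

definition distinct_cosets :: "int ^ 'n ^ 'n \<Rightarrow> (int ^ 'n) set \<Rightarrow> bool" where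
  "distinct_cosets A D \<longleftrightarrow> inj_on (\<lambda>b. {b + A *v v | v. True}) D"

definition real_vec :: "int ^ 'n \<Rightarrow> real ^ 'n" where
  "real_vec b = (\<chi> i. real_of_int (b $ i))"

primrec Rprod :: "(nat \<Rightarrow> int ^ 'n ^ 'n) \<Rightarrow> nat \<Rightarrow> int ^ 'n ^ 'n" where
  "Rprod R 0 = mat 1"
| "Rprod R (Suc n) = R (Suc n) ** Rprod R n"

definition Rmat :: "(nat \<Rightarrow> int ^ 'n ^ 'n) \<Rightarrow> nat \<Rightarrow> real ^ 'n ^ 'n" where
  "Rmat R n = map_matrix real_of_int (Rprod R n)"

definition scaled_digit :: "(nat \<Rightarrow> int ^ 'n ^ 'n) \<Rightarrow> nat \<Rightarrow> int ^ 'n \<Rightarrow> real ^ 'n" where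
  "scaled_digit R k b = matrix_inv (Rmat R k) *v real_vec b"

text \<open>The measure \<open>\<delta>\<^sub>A\<close>, as a Borel measure: the mass of \<open>E\<close> is \<open>card (A \<inter> E) / card A\<close>.
  It is only meaningful for finite nonempty \<open>A\<close>.\<close>

definition delta_set :: "(real ^ 'n) set \<Rightarrow> (real ^ 'n) measure" where
  "delta_set A = distr (uniform_count_measure A) borel (\<lambda>x. x)"

primrec partial_convolution ::
    "(nat \<Rightarrow> int ^ 'n ^ 'n) \<Rightarrow> (nat \<Rightarrow> (int ^ 'n) set) \<Rightarrow> nat \<Rightarrow> (real ^ 'n) measure" where
  "partial_convolution R B 0 = return borel 0"
| "partial_convolution R B (Suc n) =
     convolution (partial_convolution R B n) (delta_set (scaled_digit R (Suc n) ` B (Suc n)))"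

text \<open>The library's \<open>weak_conv_m\<close> is restricted to measures on the real line.\<close>

definition weakly_converges :: "(nat \<Rightarrow> (real ^ 'n) measure) \<Rightarrow> (real ^ 'n) measure \<Rightarrow> bool" where
  "weakly_converges M N \<longleftrightarrow>
     (\<forall>f :: real ^ 'n \<Rightarrow> real. continuous_on UNIV f \<and> bounded (range f) \<longrightarrow>
        (\<lambda>n. \<integral>x. f x \<partial>M n) \<longlonglongrightarrow> (\<integral>x. f x \<partial>N))"

definition infinite_convolution ::
    "(nat \<Rightarrow> int ^ 'n ^ 'n) \<Rightarrow> (nat \<Rightarrow> (int ^ 'n) set) \<Rightarrow> (real ^ 'n) measure \<Rightarrow> bool" where
  "infinite_convolution R B \<mu> \<longleftrightarrow>
     prob_space \<mu> \<and> sets \<mu> = sets borel \<and> weakly_converges (partial_convolution R B) \<mu>"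

definition digit_series_converge ::
    "(nat \<Rightarrow> int ^ 'n ^ 'n) \<Rightarrow> (nat \<Rightarrow> (int ^ 'n) set) \<Rightarrow> bool" where
  "digit_series_converge R B \<longleftrightarrow>
     (\<forall>n b. (\<forall>k>n. b k \<in> B k) \<longrightarrow>
        summable (\<lambda>k. scaled_digit R (n + 1 + k) (b (n + 1 + k))))"

definition Bset ::
    "(nat \<Rightarrow> int ^ 'n ^ 'n) \<Rightarrow> (nat \<Rightarrow> (int ^ 'n) set) \<Rightarrow> nat \<Rightarrow> (real ^ 'n) set" where
  "Bset R B n = {Rmat R n *v (\<Sum>k=1..n. scaled_digit R k (b k)) | b. \<forall>k\<in>{1..n}. b k \<in> B k}"

definition Kset ::
    "(nat \<Rightarrow> int ^ 'n ^ 'n) \<Rightarrow> (nat \<Rightarrow> (int ^ 'n) set) \<Rightarrow> nat \<Rightarrow> (real ^ 'n) set" where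
  "Kset R B n = {(\<Sum>k. scaled_digit R (n + 1 + k) (b (n + 1 + k))) | b. \<forall>k>n. b k \<in> B k}"

text \<open>If the digit series converge and the digit sets are finite, the sets \<open>Kset R B n\<close> are
  compact, so the overlaps below are Borel sets.\<close>

definition no_overlap ::
    "(nat \<Rightarrow> int ^ 'n ^ 'n) \<Rightarrow> (nat \<Rightarrow> (int ^ 'n) set) \<Rightarrow> (real ^ 'n) measure \<Rightarrow> bool" where
  "no_overlap R B \<mu> \<longleftrightarrow>
     (\<forall>n\<ge>1. \<forall>b\<in>Bset R B n. \<forall>b'\<in>Bset R B n. b \<noteq> b' \<longrightarrow>
        emeasure \<mu> ((\<lambda>x. matrix_inv (Rmat R n) *v b + x) ` Kset R B n \<inter>
                    (\<lambda>x. matrix_inv (Rmat R n) *v b' + x) ` Kset R B n) = 0)"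

definition in_L2 :: "'a measure \<Rightarrow> ('a \<Rightarrow> complex) \<Rightarrow> bool" where
  "in_L2 M f \<longleftrightarrow> f \<in> borel_measurable M \<and> integrable M (\<lambda>x. (cmod (f x))\<^sup>2)"

definition L2_norm :: "'a measure \<Rightarrow> ('a \<Rightarrow> complex) \<Rightarrow> real" where
  "L2_norm M f = sqrt (\<integral>x. (cmod (f x))\<^sup>2 \<partial>M)"

text \<open>Riesz sequences in \<open>L\<^sup>2(M)\<close>, for a family \<open>f\<close> indexed by \<open>I\<close>; the finitely supported
  scalar sequences are given by a finite \<open>F \<subseteq> I\<close> and coefficients on \<open>F\<close>.\<close>

definition Riesz_sequence_L2 :: "'a measure \<Rightarrow> 'i set \<Rightarrow> ('i \<Rightarrow> 'a \<Rightarrow> complex) \<Rightarrow> bool" where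
  "Riesz_sequence_L2 M I f \<longleftrightarrow>
     (\<forall>k\<in>I. in_L2 M (f k)) \<and>
     (\<exists>C>0. \<exists>D>0. \<forall>F (a :: 'i \<Rightarrow> complex). finite F \<and> F \<subseteq> I \<longrightarrow>
        C * (\<Sum>k\<in>F. (cmod (a k))\<^sup>2) \<le> (L2_norm M (\<lambda>x. \<Sum>k\<in>F. a k * f k x))\<^sup>2 \<and>
        (L2_norm M (\<lambda>x. \<Sum>k\<in>F. a k * f k x))\<^sup>2 \<le> D * (\<Sum>k\<in>F. (cmod (a k))\<^sup>2))"

definition expo :: "real ^ 'n \<Rightarrow> real ^ 'n \<Rightarrow> complex" where
  "expo l x = exp (2 * of_real pi * \<i> * of_real (l \<bullet> x))"

end

theory Submission
  imports Defs "HOL-Real_Asymp.Real_Asymp"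
begin

text \<open>The measure \<open>\<mu>\<close> has no atoms: since the digits lie in distinct cosets, all the sums
  \<open>R\<^sub>1\<inverse>b\<^sub>1 + \<dots> + R\<^sub>n\<inverse>b\<^sub>n\<close> (with the products of the \<open>R\<^sub>k\<close>) are distinct points of a lattice,
  so small balls have mass at most the reciprocal of the number of sums under the \<open>n\<close>-th partial
  convolution; further convolution and the weak limit preserve this bound. By Wiener's lemma, the
  averages of \<open>\<bar>\<mu>^(\<xi> - f)\<bar>\<^sup>2\<close> over large boxes of \<open>\<xi>\<close> then tend to the sum of the squared
  masses of the atoms, which is 0. So frequencies \<open>\<lambda>\<^sub>n\<close> can be chosen one after the other with
  \<open>\<mu>^(\<lambda>\<^sub>n - \<lambda>\<^sub>k)\<close> tiny for all \<open>k < n\<close>, which makes the Gram matrix of the exponentials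
  a small perturbation of the identity.\<close>

subsection \<open>Exponential Riesz sequences for atomless measures\<close>

definition fourier :: "(real ^ 'n) measure \<Rightarrow> real ^ 'n \<Rightarrow> complex" where
  "fourier M \<xi> = (\<integral>x. expo \<xi> x \<partial>M)"

lemma norm_expo [simp]: "cmod (expo l x) = 1"
proof -
  have "2 * of_real pi * \<i> * of_real (l \<bullet> x) = \<i> * complex_of_real (2 * pi * (l \<bullet> x))"
    by simp
  then show ?thesis
    unfolding expo_def by (metis norm_exp_i_times)
qed

lemma cnj_expo: "cnj (expo l x) = expo l (- x)"
  by (simp add: expo_def exp_cnj)

lemma expo_mult_cnj: "expo l x * cnj (expo l y) = expo l (x - y)"
  unfolding cnj_expo by (simp add: expo_def inner_diff_right field_simps flip: exp_add)

lemma expo_mult_cnj_freq: "expo k x * cnj (expo l x) = expo (k - l) x"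
  unfolding cnj_expo by (simp add: expo_def inner_diff_left field_simps flip: exp_add)

lemma expo_diff: "expo (k - l) x = expo k x * expo (- l) x"
  by (simp add: expo_def inner_diff_left field_simps flip: exp_add)

lemma expo_measurable [measurable]: "expo l \<in> borel_measurable borel"
  unfolding expo_def by (intro borel_measurable_continuous_onI continuous_intros)

lemma integrable_expo [simp]:
  assumes "finite_measure M" and [measurable_cong]: "sets M = sets borel"
  shows "integrable M (expo l)"
  using assms(1) by (intro finite_measure.integrable_const_bound[where B = 1]) auto

section \<open>Averages of exponentials over frequency grids\<close>

definition grid :: "nat \<Rightarrow> ('n::finite \<Rightarrow> nat) set" where
  "grid N = PiE UNIV (\<lambda>_. {..<N\<^sup>2})"

text \<open>The frequencies fill the box \<open>[0, N)\<close> in each coordinate with step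
  \<open>1 / N\<close>. The box grows to produce cancellation. The mesh shrinks so that a fixed
  nonzero point eventually leaves the dual lattice of vectors with coordinates in \<open>N\<close>
  times the integers, where the mean is 1.\<close>

definition freq :: "nat \<Rightarrow> ('n::finite \<Rightarrow> nat) \<Rightarrow> real ^ 'n" where
  "freq N p = (\<chi> i. real (p i) / real N)"

definition grid_mean :: "nat \<Rightarrow> real ^ 'n \<Rightarrow> complex" where
  "grid_mean N z = (\<Sum>p\<in>grid N. expo (freq N p) z) / of_nat (card (grid N :: ('n \<Rightarrow> nat) set))"

lemma finite_grid [simp]: "finite (grid N)"
  by (simp add: grid_def finite_PiE)

lemma card_grid: "card (grid N :: ('n::finite \<Rightarrow> nat) set) = (N\<^sup>2) ^ CARD('n)"
  by (simp add: grid_def card_PiE)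

lemma norm_grid_mean_le:
  fixes z :: "real ^ 'n"
  shows "cmod (grid_mean N z) \<le> 1"
proof -
  have "cmod (\<Sum>p\<in>grid N. expo (freq N p) z) \<le> (\<Sum>p\<in>(grid N :: ('n \<Rightarrow> nat) set). 1)"
    by (rule order_trans[OF norm_sum]) simp
  then show ?thesis
    by (auto simp: grid_mean_def norm_divide divide_le_eq_1 card_gt_0_iff)
qed

lemma grid_mean_measurable [measurable]: "grid_mean N \<in> borel_measurable borel"
  unfolding grid_mean_def by measurable

text \<open>The exponential of a sum over coordinates is a product, so the sum over the grid splits
  into one geometric sum per coordinate.\<close>

lemma grid_mean_prod:
  fixes z :: "real ^ 'n"
  shows "grid_mean N z = (\<Prod>i\<in>UNIV. (\<Sum>k<N\<^sup>2. cis (2 * pi * z $ i / N) ^ k) / of_nat (N\<^sup>2))"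
proof -
  have e: "expo (freq N p) z = (\<Prod>i\<in>UNIV. cis (2 * pi * z $ i / N) ^ p i)" for p :: "'n \<Rightarrow> nat"
  proof -
    have "expo (freq N p) z = exp (\<Sum>i\<in>UNIV. \<i> * of_real (real (p i) * (2 * pi * z $ i / N)))"
      by (auto simp: expo_def freq_def inner_vec_def sum_distrib_left mult_ac intro!: arg_cong[where f = exp] sum.cong)
    also have "\<dots> = (\<Prod>i\<in>UNIV. cis (real (p i) * (2 * pi * z $ i / N)))"
      by (simp add: exp_sum cis_conv_exp)
    finally show ?thesis
      by (simp only: Complex.DeMoivre)
  qed
  have "(\<Sum>p\<in>grid N. expo (freq N p) z) = (\<Prod>i\<in>UNIV. \<Sum>k<N\<^sup>2. cis (2 * pi * z $ i / N) ^ k)"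
    unfolding e grid_def by (subst prod_sum_PiE) auto
  then show ?thesis
    by (simp add: grid_mean_def card_grid prod_dividef)
qed

lemma norm_one_minus_cis: "cmod (1 - cis t) = 2 * \<bar>sin (t / 2)\<bar>"
proof -
  have "(cmod (1 - cis t))\<^sup>2 = (1 - cos t)\<^sup>2 + (sin t)\<^sup>2"
    by (simp add: cmod_power2)
  also have "\<dots> = 2 - 2 * cos t"
    using sin_cos_squared_add[of t] by (simp add: power2_eq_square algebra_simps)
  also have "\<dots> = (2 * \<bar>sin (t / 2)\<bar>)\<^sup>2"
    using cos_double_sin[of "t / 2"] by (simp add: power_mult_distrib)
  finally show ?thesis
    by (rule power2_eq_imp_eq) auto
qed

text \<open>A geometric sum with ratio \<open>c\<close> on the unit circle is at most
  \<open>2 / cmod (1 - c)\<close>. Here that is of order \<open>N\<close>, so division by the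
  \<open>N^2\<close> terms leaves order \<open>1 / N\<close>.\<close>

lemma cis_mean_tendsto_0:
  fixes t :: real
  assumes "t \<noteq> 0"
  shows "(\<lambda>N::nat. cmod ((\<Sum>k<N\<^sup>2. cis (2 * pi * t / N) ^ k) / of_nat (N\<^sup>2))) \<longlonglongrightarrow> 0"
proof (rule Lim_null_comparison)
  define s where "s = \<bar>t\<bar>"
  have s: "s > 0" using assms by (simp add: s_def)
  show "(\<lambda>N::nat. 1 / (real N ^ 2 * sin (pi * s / real N))) \<longlonglongrightarrow> 0"
    using s by real_asymp
  \<comment> \<open>For large \<open>N\<close> the angle lies strictly between 0 and
    \<open>pi\<close>. This keeps the ratio \<open>c\<close> below different from 1, so the closed
    form of the geometric sum applies.\<close>
  have "eventually (\<lambda>N::nat. sin (pi * s / real N) > 0) sequentially"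
    using s by real_asymp
  then show "\<forall>\<^sub>F N::nat in sequentially.
      norm (cmod ((\<Sum>k<N\<^sup>2. cis (2 * pi * t / N) ^ k) / of_nat (N\<^sup>2))) \<le> 1 / (real N ^ 2 * sin (pi * s / real N))"
  proof eventually_elim
    case (elim N)
    define c where "c = cis (2 * pi * t / N)"
    have "cmod (1 - c) = 2 * \<bar>sin (pi * t / N)\<bar>"
      by (simp add: c_def norm_one_minus_cis)
    also have "\<bar>sin (pi * t / N)\<bar> = \<bar>sin (pi * s / N)\<bar>"
      by (cases "t \<ge> 0") (auto simp: s_def)
    finally have c: "cmod (1 - c) = 2 * sin (pi * s / N)"
      using elim by simp
    then have c1: "c \<noteq> 1" using elim by auto
    have "cmod (1 - c ^ N\<^sup>2) \<le> 2"
      using norm_triangle_ineq4[of 1 "c ^ N\<^sup>2"] by (simp add: c_def norm_power)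
    then have "cmod (1 - c ^ N\<^sup>2) / cmod (1 - c) \<le> 2 / (2 * sin (pi * s / N))"
      unfolding c using elim by (intro divide_right_mono) auto
    moreover have "cmod (\<Sum>k<N\<^sup>2. c ^ k) = cmod (1 - c ^ N\<^sup>2) / cmod (1 - c)"
      unfolding sum_gp_strict using c1 by (simp add: norm_divide)
    ultimately have "cmod (\<Sum>k<N\<^sup>2. c ^ k) \<le> 2 / (2 * sin (pi * s / N))"
      by simp
    then have "cmod (\<Sum>k<N\<^sup>2. c ^ k) / real N ^ 2 \<le> 2 / (2 * sin (pi * s / N)) / real N ^ 2"
      by (rule divide_right_mono) simp
    then show ?case
      by (simp add: c_def norm_divide norm_power field_simps)
  qed
qed

text \<open>One nonzero coordinate suffices: its factor tends to 0, and all other factors have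
  modulus at most 1.\<close>

lemma grid_mean_tendsto_0:
  fixes z :: "real ^ 'n"
  assumes "z \<noteq> 0"
  shows "(\<lambda>N. cmod (grid_mean N z)) \<longlonglongrightarrow> 0"
proof -
  obtain i where i: "z $ i \<noteq> 0"
    using assms by (auto simp: vec_eq_iff)
  let ?g = "\<lambda>N j. cmod ((\<Sum>k<N\<^sup>2. cis (2 * pi * z $ j / real N) ^ k) / of_nat (N\<^sup>2))"
  have g1: "?g N j \<le> 1" for N j
  proof -
    have "cmod (\<Sum>k<N\<^sup>2. cis (2 * pi * z $ j / real N) ^ k) \<le> (\<Sum>k<N\<^sup>2. 1)"
      by (rule order_trans[OF norm_sum]) (simp add: norm_power)
    then show ?thesis
      by (cases "N = 0") (simp_all add: norm_divide norm_power divide_le_eq_1)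
  qed
  have "cmod (grid_mean N z) \<le> ?g N i" for N
  proof -
    have "cmod (grid_mean N z) = ?g N i * (\<Prod>j\<in>UNIV - {i}. ?g N j)"
      unfolding grid_mean_prod prod_norm[symmetric] by (rule prod.remove) auto
    also have "\<dots> \<le> ?g N i * 1"
      by (intro mult_left_mono prod_le_1) (auto intro: g1 simp del: of_nat_power)
    finally show ?thesis by simp
  qed
  then show ?thesis
    by (intro Lim_null_comparison[OF _ cis_mean_tendsto_0[OF i]] always_eventually) auto
qed

text \<open>The kernel tends to 0 off the diagonal, and without atoms every slice of the diagonal is
  null. Dominated convergence with bound 1 treats first the inner and then the outer
  integral.\<close>

lemma grid_mean_integral_tendsto_0:
  fixes M :: "(real ^ 'n) measure"
  assumes P: "prob_space M" and S [measurable_cong]: "sets M = sets borel" and atomless: "\<And>x. measure M {x} = 0"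
  shows "(\<lambda>N. \<integral>x. \<integral>y. cmod (grid_mean N (x - y)) \<partial>M \<partial>M) \<longlonglongrightarrow> 0"
proof -
  interpret prob_space M by fact
  have [simp]: "{x} \<in> sets M" for x by (simp add: S)
  have in0: "(\<lambda>N. \<integral>y. cmod (grid_mean N (x - y)) \<partial>M) \<longlonglongrightarrow> (\<integral>y. 0 \<partial>M)" for x
  proof (rule integral_dominated_convergence[where w = "\<lambda>_. 1"])
    have "AE y in M. y \<noteq> x"
      using atomless[of x] by (intro AE_I[where N = "{x}"]) (auto simp: emeasure_eq_measure)
    then show "AE y in M. (\<lambda>N. cmod (grid_mean N (x - y))) \<longlonglongrightarrow> 0"
      by eventually_elim (rule grid_mean_tendsto_0, simp)
  qed (auto simp: norm_grid_mean_le)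
  have "(\<lambda>N. \<integral>x. \<integral>y. cmod (grid_mean N (x - y)) \<partial>M \<partial>M) \<longlonglongrightarrow> (\<integral>x. 0 \<partial>M)"
  proof (rule integral_dominated_convergence[where w = "\<lambda>_. 1"])
    show "AE x in M. norm (\<integral>y. cmod (grid_mean N (x - y)) \<partial>M) \<le> 1" for N
    proof (rule AE_I2)
      fix x
      have "(\<integral>y. cmod (grid_mean N (x - y)) \<partial>M) \<le> (\<integral>y. 1 \<partial>M)"
        by (intro integral_mono integrable_const_bound[where B = 1])
           (auto simp: norm_grid_mean_le)
      then show "norm (\<integral>y. cmod (grid_mean N (x - y)) \<partial>M) \<le> 1"
        by (simp add: prob_space integral_nonneg)
    qed
  qed (use in0 in auto)
  then show ?thesis by simp
qed

section \<open>Means of the squared Fourier transform, in the manner of Wiener's lemma\<close>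

lemma cmod_fourier_squared:
  fixes M :: "(real ^ 'n) measure"
  assumes P: "prob_space M" and S: "sets M = sets borel"
  shows "complex_of_real ((cmod (fourier M \<xi>))\<^sup>2) = (\<integral>x. \<integral>y. expo \<xi> (x - y) \<partial>M \<partial>M)"
proof -
  interpret prob_space M by fact
  have "complex_of_real ((cmod (fourier M \<xi>))\<^sup>2) = fourier M \<xi> * cnj (fourier M \<xi>)"
    by (rule complex_norm_square)
  also have "\<dots> = (\<integral>x. expo \<xi> x * cnj (fourier M \<xi>) \<partial>M)"
    by (simp add: fourier_def)
  also have "\<dots> = (\<integral>x. \<integral>y. expo \<xi> x * cnj (expo \<xi> y) \<partial>M \<partial>M)"
    by (simp add: fourier_def)
  finally show ?thesis by (simp add: expo_mult_cnj)
qed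

text \<open>Shifting the frequencies by \<open>f\<close> only multiplies the averaging kernel by a unimodular factor,
  so the bound is uniform in \<open>f\<close>.\<close>

lemma grid_mean_fourier_le:
  fixes M :: "(real ^ 'n) measure"
  assumes P: "prob_space M" and S: "sets M = sets borel"
  shows "(\<Sum>p\<in>grid N. (cmod (fourier M (freq N p - f)))\<^sup>2)
      \<le> card (grid N :: ('n \<Rightarrow> nat) set) * (\<integral>x. \<integral>y. cmod (grid_mean N (x - y)) \<partial>M \<partial>M)"
proof -
  interpret prob_space M by fact
  note [measurable_cong] = S
  let ?c = "of_nat (card (grid N :: ('n \<Rightarrow> nat) set)) :: complex"
  have sum: "(\<Sum>p\<in>grid N. expo (freq N p - f) z) = ?c * (grid_mean N z * expo (- f) z)" for z :: "real ^ 'n"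
    by (cases "?c = 0") (auto simp: grid_mean_def expo_diff sum_distrib_right)
  have int: "integrable M (\<lambda>y. expo l (x - y))" for l x
    by (intro integrable_const_bound[where B = 1]) auto
  \<comment> \<open>Factoring \<open>expo l (x - y)\<close> turns the inner integral into a constant
    multiple of \<open>expo l x\<close>.\<close>
  have int': "integrable M (\<lambda>x. \<integral>y. expo l (x - y) \<partial>M)" for l
    by (simp add: expo_mult_cnj[symmetric] S)
  have "complex_of_real (\<Sum>p\<in>grid N. (cmod (fourier M (freq N p - f)))\<^sup>2)
      = (\<Sum>p\<in>grid N. \<integral>x. \<integral>y. expo (freq N p - f) (x - y) \<partial>M \<partial>M)"
    by (simp only: of_real_sum cmod_fourier_squared[OF P S])
  also have "\<dots> = (\<integral>x. (\<Sum>p\<in>grid N. \<integral>y. expo (freq N p - f) (x - y) \<partial>M) \<partial>M)"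
    by (rule Bochner_Integration.integral_sum[symmetric]) (rule int')
  also have "\<dots> = (\<integral>x. \<integral>y. (\<Sum>p\<in>grid N. expo (freq N p - f) (x - y)) \<partial>M \<partial>M)"
    by (intro Bochner_Integration.integral_cong refl Bochner_Integration.integral_sum[symmetric] int)
  also have "\<dots> = ?c * (\<integral>x. \<integral>y. grid_mean N (x - y) * expo (- f) (x - y) \<partial>M \<partial>M)"
    by (simp add: sum)
  finally have "complex_of_real (\<Sum>p\<in>grid N. (cmod (fourier M (freq N p - f)))\<^sup>2) =
      ?c * (\<integral>x. \<integral>y. grid_mean N (x - y) * expo (- f) (x - y) \<partial>M \<partial>M)" .
  \<comment> \<open>The sum on the left is a nonnegative real, so it equals its own modulus.\<close>
  then have "(\<Sum>p\<in>grid N. (cmod (fourier M (freq N p - f)))\<^sup>2)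
      = card (grid N :: ('n \<Rightarrow> nat) set) * cmod (\<integral>x. \<integral>y. grid_mean N (x - y) * expo (- f) (x - y) \<partial>M \<partial>M)"
    by (metis (no_types, lifting) norm_mult norm_of_nat norm_of_real abs_of_nonneg sum_nonneg zero_le_power2)
  also have "cmod (\<integral>x. \<integral>y. grid_mean N (x - y) * expo (- f) (x - y) \<partial>M \<partial>M)
      \<le> (\<integral>x. cmod (\<integral>y. grid_mean N (x - y) * expo (- f) (x - y) \<partial>M) \<partial>M)"
    by (rule integral_norm_bound)
  also have "\<dots> \<le> (\<integral>x. \<integral>y. cmod (grid_mean N (x - y)) \<partial>M \<partial>M)"
  proof (rule integral_mono)
    have le1: "(\<integral>y. cmod (grid_mean N (x - y)) \<partial>M) \<le> 1" for x
    proof -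
      have "(\<integral>y. cmod (grid_mean N (x - y)) \<partial>M) \<le> (\<integral>y. 1 \<partial>M)"
        by (intro integral_mono integrable_const_bound[where B = 1]) (auto simp: norm_grid_mean_le)
      then show ?thesis by (simp add: prob_space)
    qed
    show le: "cmod (\<integral>y. grid_mean N (x - y) * expo (- f) (x - y) \<partial>M)
        \<le> (\<integral>y. cmod (grid_mean N (x - y)) \<partial>M)" for x
      by (rule order_trans[OF integral_norm_bound]) (simp add: norm_mult)
    show "integrable M (\<lambda>x. \<integral>y. cmod (grid_mean N (x - y)) \<partial>M)"
      by (intro integrable_const_bound[where B = 1]) (auto simp: le1 integral_nonneg)
    show "integrable M (\<lambda>x. cmod (\<integral>y. grid_mean N (x - y) * expo (- f) (x - y) \<partial>M))"
      by (intro integrable_const_bound[where B = 1]) (auto intro: order_trans[OF le le1])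
  qed
  finally show ?thesis by (simp add: mult_left_mono)
qed

text \<open>Averaging: if every grid frequency failed for some \<open>f\<close>, the double sum over
  the grid and \<open>F\<close> would be at least \<open>\<epsilon>^2\<close> times the size of the
  grid. The bound on grid means makes it smaller than that for large \<open>N\<close>.\<close>

lemma fourier_small_shift:
  fixes M :: "(real ^ 'n) measure"
  assumes P: "prob_space M" and S: "sets M = sets borel" and atomless: "\<And>x. measure M {x} = 0"
    and F: "finite F" and e: "\<epsilon> > 0"
  shows "\<exists>\<xi>. \<forall>f\<in>F. cmod (fourier M (\<xi> - f)) < \<epsilon>"
proof -
  interpret prob_space M by fact
  let ?I = "\<lambda>N. \<integral>x. \<integral>y. cmod (grid_mean N (x - y)) \<partial>M \<partial>M"
  have "(\<lambda>N. real (card F) * ?I N) \<longlonglongrightarrow> real (card F) * 0"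
    by (intro tendsto_mult tendsto_const grid_mean_integral_tendsto_0 P S atomless)
  then have "\<forall>\<^sub>F N in sequentially. real (card F) * ?I N < \<epsilon>\<^sup>2"
    by (rule order_tendstoD) (use e in simp)
  \<comment> \<open>The condition \<open>N \<ge> 1\<close> keeps the grid nonempty, as the strict
    inequality at the end requires.\<close>
  then obtain N where N: "real (card F) * ?I N < \<epsilon>\<^sup>2" "N \<ge> 1"
    using eventually_conj[OF _ eventually_ge_at_top[of 1]] eventually_happens by fastforce
  let ?G = "grid N :: ('n \<Rightarrow> nat) set"
  have G: "card ?G > 0" using N by (simp add: card_grid)
  have "\<exists>p\<in>?G. \<forall>f\<in>F. cmod (fourier M (freq N p - f)) < \<epsilon>"
  proof (rule ccontr)
    assume "\<not> ?thesis"
    then have big: "\<exists>f\<in>F. \<epsilon> \<le> cmod (fourier M (freq N p - f))" if "p \<in> ?G" for p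
      using that by (meson linorder_not_le)
    have "card ?G * \<epsilon>\<^sup>2 = (\<Sum>p\<in>?G. \<epsilon>\<^sup>2)" by simp
    also have "\<dots> \<le> (\<Sum>p\<in>?G. \<Sum>f\<in>F. (cmod (fourier M (freq N p - f)))\<^sup>2)"
    proof (rule sum_mono)
      fix p assume "p \<in> ?G"
      then obtain f where f: "f \<in> F" "\<epsilon> \<le> cmod (fourier M (freq N p - f))"
        using big by blast
      then have "\<epsilon>\<^sup>2 \<le> (cmod (fourier M (freq N p - f)))\<^sup>2"
        using e by (intro power_mono) auto
      also have "\<dots> \<le> (\<Sum>f\<in>F. (cmod (fourier M (freq N p - f)))\<^sup>2)"
        using f F by (intro member_le_sum) auto
      finally show "\<epsilon>\<^sup>2 \<le> \<dots>" .
    qed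
    also have "\<dots> = (\<Sum>f\<in>F. \<Sum>p\<in>?G. (cmod (fourier M (freq N p - f)))\<^sup>2)"
      by (rule sum.swap)
    also have "\<dots> \<le> (\<Sum>f\<in>F. card ?G * ?I N)"
      by (intro sum_mono grid_mean_fourier_le P S)
    also have "\<dots> = card ?G * (card F * ?I N)" by simp
    also have "\<dots> < card ?G * \<epsilon>\<^sup>2"
      using N G by (intro mult_strict_left_mono) auto
    finally show False by simp
  qed
  then show ?thesis by blast
qed

section \<open>The Gram matrix of exponentials and the choice of frequencies\<close>

lemma L2_norm_expo_sum:
  fixes M :: "(real ^ 'n) measure" and l :: "'i \<Rightarrow> real ^ 'n"
  assumes P: "prob_space M" and S: "sets M = sets borel"
  shows "complex_of_real ((L2_norm M (\<lambda>x. \<Sum>k\<in>F. a k * expo (l k) x))\<^sup>2)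
    = (\<Sum>j\<in>F. \<Sum>k\<in>F. a j * cnj (a k) * fourier M (l j - l k))"
proof -
  interpret prob_space M by fact
  let ?g = "\<lambda>x. \<Sum>k\<in>F. a k * expo (l k) x"
  have "complex_of_real ((L2_norm M ?g)\<^sup>2) = (\<integral>x. complex_of_real ((cmod (?g x))\<^sup>2) \<partial>M)"
    by (simp add: L2_norm_def del: of_real_power)
  also have "\<dots> = (\<integral>x. (\<Sum>j\<in>F. \<Sum>k\<in>F. a j * cnj (a k) * expo (l j - l k) x) \<partial>M)"
    unfolding complex_norm_square
    by (intro Bochner_Integration.integral_cong refl)
       (simp add: sum_product mult_ac flip: expo_mult_cnj_freq)
  also have "\<dots> = (\<Sum>j\<in>F. \<Sum>k\<in>F. a j * cnj (a k) * fourier M (l j - l k))"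
    by (simp add: fourier_def S)
  finally show ?thesis .
qed

text \<open>The off-diagonal Gram entries are dominated by a rank-one matrix with weights
  \<open>(1/2)^j\<close>. By Cauchy-Schwarz and the series of \<open>(1/4)^j\<close>, with sum 4/3,
  the perturbation is at most 1/4 * 4/3 = 1/3 of the squared norm, uniformly in
  \<open>F\<close>.\<close>

lemma L2_norm_expo_sum_near:
  fixes M :: "(real ^ 'n) measure" and l :: "nat \<Rightarrow> real ^ 'n"
  assumes P: "prob_space M" and S: "sets M = sets borel" and F: "finite F"
    and small: "\<And>j k. j \<noteq> k \<Longrightarrow> cmod (fourier M (l j - l k)) \<le> (1 / 4) * (1 / 2) ^ j * (1 / 2) ^ k"
  shows "\<bar>(L2_norm M (\<lambda>x. \<Sum>k\<in>F. a k * expo (l k) x))\<^sup>2 - (\<Sum>k\<in>F. (cmod (a k))\<^sup>2)\<bar>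
    \<le> 1 / 3 * (\<Sum>k\<in>F. (cmod (a k))\<^sup>2)"
proof -
  interpret prob_space M by fact
  let ?S = "\<Sum>k\<in>F. (cmod (a k))\<^sup>2"
  have one: "fourier M 0 = 1"
    by (simp add: fourier_def expo_def prob_space)
  let ?d = "\<lambda>j k. if j = k then a j * cnj (a k) else 0"
  have diag: "complex_of_real ?S = (\<Sum>j\<in>F. \<Sum>k\<in>F. ?d j k)"
    using F by (simp add: complex_norm_square sum.delta del: of_real_power)
  have "\<bar>(L2_norm M (\<lambda>x. \<Sum>k\<in>F. a k * expo (l k) x))\<^sup>2 - ?S\<bar>
      = cmod ((\<Sum>j\<in>F. \<Sum>k\<in>F. a j * cnj (a k) * fourier M (l j - l k)) - (\<Sum>j\<in>F. \<Sum>k\<in>F. ?d j k))"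
    unfolding diag[symmetric] L2_norm_expo_sum[OF P S, symmetric] of_real_diff[symmetric] norm_of_real ..
  also have "\<dots> = cmod (\<Sum>j\<in>F. \<Sum>k\<in>F. a j * cnj (a k) * fourier M (l j - l k) - ?d j k)"
    by (simp add: sum_subtractf)
  also have "\<dots> \<le> (\<Sum>j\<in>F. \<Sum>k\<in>F. 1 / 4 * ((1 / 2) ^ j * cmod (a j)) * ((1 / 2) ^ k * cmod (a k)))"
  proof (intro sum_norm_le)
    fix j k
    show "cmod (a j * cnj (a k) * fourier M (l j - l k) - ?d j k)
        \<le> 1 / 4 * ((1 / 2) ^ j * cmod (a j)) * ((1 / 2) ^ k * cmod (a k))"
    \<comment> \<open>Diagonal terms cancel exactly because the Fourier transform at 0 is 1.\<close>
    proof (cases "j = k")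
      case False
      then have "cmod (a j) * cmod (a k) * cmod (fourier M (l j - l k))
          \<le> cmod (a j) * cmod (a k) * ((1 / 4) * (1 / 2) ^ j * (1 / 2) ^ k)"
        by (intro mult_left_mono small) auto
      with False show ?thesis by (simp add: norm_mult mult_ac)
    qed (simp add: one)
  qed
  also have "\<dots> = 1 / 4 * (\<Sum>j\<in>F. (1 / 2) ^ j * cmod (a j))\<^sup>2"
    by (simp add: power2_eq_square sum_product sum_distrib_left mult_ac)
  also have "\<dots> \<le> 1 / 4 * ((\<Sum>j\<in>F. ((1 / 2) ^ j)\<^sup>2) * ?S)"
    by (intro mult_left_mono Cauchy_Schwarz_ineq_sum) auto
  also have "(\<Sum>j\<in>F. ((1 / 2) ^ j)\<^sup>2) \<le> (4 / 3 :: real)"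
  proof -
    have "((1 / 2) ^ j)\<^sup>2 = (1 / 4 :: real) ^ j" for j :: nat
      unfolding power_mult[symmetric] mult.commute[of j]
      unfolding power_mult by (simp add: power2_eq_square)
    then have "(\<Sum>j\<in>F. ((1 / 2) ^ j)\<^sup>2) = (\<Sum>j\<in>F. (1 / 4 :: real) ^ j)"
      by simp
    also have "\<dots> \<le> (\<Sum>j. (1 / 4) ^ j)"
      using F by (intro sum_le_suminf summable_geometric) auto
    also have "\<dots> = 4 / 3" by (simp add: suminf_geometric)
    finally show ?thesis .
  qed
  finally show ?thesis by (simp add: mult_right_mono sum_nonneg)
qed

theorem atomless_imp_exponential_Riesz_sequence:
  fixes M :: "(real ^ 'n) measure"
  assumes P: "prob_space M" and S: "sets M = sets borel" and atomless: "\<And>x. measure M {x} = 0"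
  shows "\<exists>\<Lambda> :: (real ^ 'n) set. infinite \<Lambda> \<and> Riesz_sequence_L2 M \<Lambda> expo"
proof -
  interpret prob_space M by fact
  have fourier_sym: "cmod (fourier M (x - y)) = cmod (fourier M (y - x))" for x y
  proof -
    have "expo (y - x) z = cnj (expo (x - y) z)" for z
      by (simp add: expo_def inner_diff_left algebra_simps exp_cnj)
    then show ?thesis by (simp add: fourier_def)
  qed
  \<comment> \<open>Each new frequency is chosen against the finitely many earlier ones, with a
    tolerance that depends only on its own index.\<close>
  have "\<exists>l. \<forall>n. \<forall>k<n. cmod (fourier M (l n - l k)) < (1 / 4) * (1 / 2) ^ n * (1 / 2) ^ n"
  proof -
    have "\<exists>l. \<forall>n::nat. (\<lambda>l n y. \<forall>k<n. cmod (fourier M (y - l k)) < (1 / 4) * (1 / 2) ^ n * (1 / 2) ^ n) l n (l n)"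
    proof (rule dependent_wellorder_choice)
      fix n :: nat and l :: "nat \<Rightarrow> real ^ 'n"
      show "\<exists>y. \<forall>k<n. cmod (fourier M (y - l k)) < (1 / 4) * (1 / 2) ^ n * (1 / 2) ^ n"
        using fourier_small_shift[OF P S atomless, of "l ` {..<n}" "(1 / 4) * (1 / 2) ^ n * (1 / 2) ^ n"]
        by auto
    qed auto
    then show ?thesis .
  qed
  then obtain l where l: "cmod (fourier M (l n - l k)) < (1 / 4) * (1 / 2) ^ n * (1 / 2) ^ n"
    if "k < n" for n k by blast
  \<comment> \<open>For \<open>k < n\<close> one factor \<open>(1/2)^n\<close> may be relaxed to
    \<open>(1/2)^k\<close>, which gives the symmetric product form needed for the rank-one
    bound.\<close>
  have l_le: "cmod (fourier M (l n - l k)) \<le> (1 / 4) * (1 / 2) ^ n * (1 / 2) ^ k" if "k < n" for n k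
  proof -
    have "(1 / 2 :: real) ^ n \<le> (1 / 2) ^ k"
      using that by (intro power_decreasing) auto
    then have "(1 / 4) * (1 / 2) ^ n * (1 / 2) ^ n \<le> (1 / 4) * (1 / 2) ^ n * (1 / 2 :: real) ^ k"
      by (intro mult_left_mono) auto
    with l[OF that] show ?thesis by linarith
  qed
  have small: "cmod (fourier M (l j - l k)) \<le> (1 / 4) * (1 / 2) ^ j * (1 / 2) ^ k" if "j \<noteq> k" for j k
    using l_le[of k j] l_le[of j k] fourier_sym[of "l j" "l k"] that
    by (cases j k rule: linorder_cases) (auto simp: mult_ac)
  \<comment> \<open>A repeated frequency would give a Fourier value of 1, above the tolerance; hence
    the chosen set is infinite.\<close>
  have "inj l"
  proof (rule linorder_injI)
    fix k n :: nat assume "k < n"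
    have "(1 / 4) * (1 / 2) ^ n * (1 / 2) ^ n \<le> (1 :: real)"
      by (intro mult_le_one power_le_one) auto
    then have "cmod (fourier M (l n - l k)) < 1"
      using l[OF \<open>k < n\<close>] by linarith
    moreover have "fourier M 0 = 1"
      by (simp add: fourier_def expo_def prob_space)
    ultimately show "l k \<noteq> l n" by auto
  qed
  have L2: "in_L2 M (expo k)" for k
    using S by (auto simp: in_L2_def cong: measurable_cong_sets)
  have "2 / 3 * (\<Sum>k\<in>F. (cmod (a k))\<^sup>2) \<le> (L2_norm M (\<lambda>x. \<Sum>k\<in>F. a k * expo k x))\<^sup>2 \<and>
      (L2_norm M (\<lambda>x. \<Sum>k\<in>F. a k * expo k x))\<^sup>2 \<le> 4 / 3 * (\<Sum>k\<in>F. (cmod (a k))\<^sup>2)"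
    if F: "finite F" "F \<subseteq> range l" for F a
  proof -
    \<comment> \<open>The Riesz property is indexed by the frequencies themselves, so a finite set
      of them is pulled back to indices of \<open>l\<close>.\<close>
    obtain G where G: "finite G" "F = l ` G"
      using finite_subset_image[OF F] by blast
    have "inj_on l G" using \<open>inj l\<close> by (rule inj_on_subset) auto
    then have "\<bar>(L2_norm M (\<lambda>x. \<Sum>k\<in>F. a k * expo k x))\<^sup>2 - (\<Sum>k\<in>F. (cmod (a k))\<^sup>2)\<bar>
        \<le> 1 / 3 * (\<Sum>k\<in>F. (cmod (a k))\<^sup>2)"
      using L2_norm_expo_sum_near[OF P S G(1), of l "a \<circ> l"] small
      by (simp add: G sum.reindex comp_def)
    then show ?thesis by linarith
  qed
  then have "Riesz_sequence_L2 M (range l) expo"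
    unfolding Riesz_sequence_L2_def using L2 by (intro conjI exI[of _ "2/3"] exI[of _ "4/3"]) auto
  moreover have "infinite (range l)"
    using \<open>inj l\<close> by (simp add: finite_image_iff)
  ultimately show ?thesis by blast
qed

subsection \<open>Infinite convolutions are atomless\<close>

lemma real_vec_add: "real_vec (b + c) = real_vec b + real_vec c"
  by (simp add: real_vec_def vec_eq_iff)

lemma real_vec_diff: "real_vec (b - c) = real_vec b - real_vec c"
  by (simp add: real_vec_def vec_eq_iff)

lemma real_vec_eq_iff [simp]: "real_vec b = real_vec c \<longleftrightarrow> b = c"
  by (simp add: real_vec_def vec_eq_iff)

lemma real_vec_mult: "map_matrix real_of_int A *v real_vec v = real_vec (A *v v)"
  by (simp add: real_vec_def vec_eq_iff matrix_vector_mult_def)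

lemma real_vec_0 [simp]: "real_vec 0 = 0"
  by (simp add: real_vec_def vec_eq_iff)

lemma real_vec_norm_less_1:
  assumes "norm (real_vec w) < 1"
  shows "w = 0"
proof -
  have "w $ i = 0" for i
    using component_le_norm_cart[of "real_vec w" i] assms by (simp add: real_vec_def)
  then show ?thesis
    by (simp add: vec_eq_iff)
qed

text \<open>A nonzero kernel vector, viewed as a complex vector, would be an eigenvector for the
  eigenvalue 0, whose modulus is not above 1.\<close>

lemma expanding_imp_invertible:
  assumes "expanding A"
  shows "invertible (map_matrix real_of_int A)"
  unfolding invertible_left_inverse matrix_left_invertible_ker
proof (intro allI impI)
  fix v :: "real ^ 'a" assume v: "map_matrix real_of_int A *v v = 0"
  define w where "w = (\<chi> i. complex_of_real (v $ i))"
  have "(map_matrix of_int A *v w) $ i = complex_of_real ((map_matrix real_of_int A *v v) $ i)" for i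
    by (simp add: matrix_vector_mult_def w_def)
  then have "map_matrix of_int A *v w = 0 *s w"
    by (simp add: v vec_eq_iff)
  then have "w = 0"
    using assms unfolding expanding_def by fastforce
  then show "v = 0"
    by (simp add: w_def vec_eq_iff)
qed

lemma Rmat_Suc: "Rmat R (Suc n) = map_matrix real_of_int (R (Suc n)) ** Rmat R n"
  by (simp add: Rmat_def matrix_matrix_mult_def vec_eq_iff)

lemma invertible_Rmat:
  assumes "\<And>j. j \<ge> 1 \<Longrightarrow> expanding (R j)"
  shows "invertible (Rmat R n)"
proof (induction n)
  case 0
  have "Rmat R 0 = mat 1"
    by (simp add: Rmat_def mat_def vec_eq_iff)
  then show ?case
    by (metis invertible_def matrix_mul_lid)
next
  case (Suc n)
  then show ?case
    unfolding Rmat_Suc by (intro invertible_mult expanding_imp_invertible assms) auto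
qed

text \<open>For an invertible product this is the inverse image of the integer lattice; it contains
  all digit sums of length \<open>n\<close>.\<close>

definition digit_lattice :: "(nat \<Rightarrow> int ^ 'n ^ 'n) \<Rightarrow> nat \<Rightarrow> (real ^ 'n) set" where
  "digit_lattice R n = {x. Rmat R n *v x \<in> range real_vec}"

section \<open>Uniform measures on finite sets and their convolutions\<close>

lemma sets_delta_set [simp]: "sets (delta_set A) = sets borel"
  by (simp add: delta_set_def)

lemma emeasure_delta_set:
  assumes "finite A" "E \<in> sets borel"
  shows "emeasure (delta_set A) E = card (A \<inter> E) / card A"
proof -
  have "(\<lambda>x. x) \<in> uniform_count_measure A \<rightarrow>\<^sub>M borel"
    by (simp add: uniform_count_measure_def)
  then show ?thesis
    using assms
    by (simp add: delta_set_def emeasure_distr emeasure_uniform_count_measure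
        space_uniform_count_measure Int_commute)
qed

lemma prob_space_delta_set:
  assumes "finite A" "A \<noteq> {}"
  shows "prob_space (delta_set A)"
  unfolding delta_set_def using assms
  by (intro prob_space.prob_space_distr prob_space_uniform_count_measure)
     (auto simp: uniform_count_measure_def)

lemma AE_delta_set:
  assumes "finite A" "A \<noteq> {}"
  shows "AE x in delta_set A. x \<in> A"
proof (rule AE_I)
  have [measurable]: "A \<in> sets borel"
    using assms by (intro borel_closed finite_imp_closed)
  show "- A \<in> sets (delta_set A)" by simp
  show "emeasure (delta_set A) (- A) = 0"
    using assms by (simp add: emeasure_delta_set)
qed auto

lemma prob_space_convolution:
  assumes "prob_space M" "prob_space N" and [measurable_cong]: "sets M = sets borel" "sets N = sets borel"
  shows "prob_space (M \<star> N)"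
proof -
  interpret M: prob_space M by fact
  interpret N: prob_space N by fact
  interpret pair_prob_space M N ..
  show ?thesis
    unfolding convolution_def by (rule prob_space_distr) measurable
qed

text \<open>Commuting the factors lets the integral run over the factor convolved last, that is,
  over the newest digit.\<close>

lemma emeasure_convolution_left:
  assumes "prob_space M" "prob_space N" "sets M = sets borel" "sets N = sets borel" "E \<in> sets borel"
  shows "emeasure (M \<star> N) E = (\<integral>\<^sup>+x. emeasure M {a. a + x \<in> E} \<partial>N)"
proof -
  have fin: "finite_measure M" "finite_measure N"
    using assms by (simp_all add: prob_space.finite_measure)
  have "space M = space borel" "space N = space borel"
    using assms(3,4) by (auto dest: sets_eq_imp_space_eq)
  then have "emeasure (N \<star> M) E = (\<integral>\<^sup>+x. emeasure M {a. a + x \<in> E} \<partial>N)"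
    using assms fin by (intro convolution_emeasure) auto
  then show ?thesis
    by (simp only: convolution_commutative[OF fin assms(4,3)])
qed

section \<open>Digit sums and the lattices containing them\<close>

locale expanding_digits =
  fixes R :: "nat \<Rightarrow> int ^ 'n ^ 'n" and B :: "nat \<Rightarrow> (int ^ 'n) set"
  assumes expanding: "j \<ge> 1 \<Longrightarrow> expanding (R j)"
    and finite_B: "j \<ge> 1 \<Longrightarrow> finite (B j)"
    and B_nonempty: "j \<ge> 1 \<Longrightarrow> B j \<noteq> {}"
    and distinct_cosets: "j \<ge> 1 \<Longrightarrow> distinct_cosets (R j) (B j)"
begin

abbreviation digits :: "nat \<Rightarrow> (real ^ 'n) set" where
  "digits n \<equiv> scaled_digit R n ` B n"

lemma Rmat_scaled_digit: "Rmat R n *v scaled_digit R n b = real_vec b"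
proof -
  have "Rmat R n ** matrix_inv (Rmat R n) = mat 1"
    using invertible_Rmat[of R n, OF expanding] someI_ex[of "\<lambda>A'. Rmat R n ** A' = mat 1 \<and> A' ** Rmat R n = mat 1"]
    unfolding invertible_def matrix_inv_def by blast
  then show ?thesis
    by (simp add: scaled_digit_def matrix_vector_mul_assoc)
qed

lemma scaled_digit_inject [simp]: "scaled_digit R n b = scaled_digit R n c \<longleftrightarrow> b = c"
  by (metis Rmat_scaled_digit real_vec_eq_iff)

text \<open>In integer coordinates, appending a digit is the affine map from \<open>u\<close> to
  \<open>R (Suc n) *v u + b\<close>, so the new digit is visible modulo the image of
  \<open>R (Suc n)\<close>.\<close>

lemma Rmat_Suc_add_scaled_digit:
  assumes "Rmat R n *v x = real_vec u"
  shows "Rmat R (Suc n) *v (x + scaled_digit R (Suc n) b) = real_vec (R (Suc n) *v u + b)"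
proof -
  have "Rmat R (Suc n) *v x = map_matrix real_of_int (R (Suc n)) *v real_vec u"
    unfolding Rmat_Suc assms[symmetric] by (simp add: matrix_vector_mul_assoc)
  then show ?thesis
    by (simp add: matrix_vector_right_distrib Rmat_scaled_digit real_vec_mult real_vec_add)
qed

lemma lattice_Suc:
  "x \<in> digit_lattice R n \<Longrightarrow> x + scaled_digit R (Suc n) b \<in> digit_lattice R (Suc n)"
  by (auto simp: digit_lattice_def Rmat_Suc_add_scaled_digit)

text \<open>In integer coordinates the equation puts \<open>b\<close> and \<open>c\<close> into the
  same coset of the image of \<open>R (Suc n)\<close>.\<close>

lemma lattice_Suc_inject:
  assumes x: "x \<in> digit_lattice R n" "y \<in> digit_lattice R n" and b: "b \<in> B (Suc n)" "c \<in> B (Suc n)"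
    and eq: "x + scaled_digit R (Suc n) b = y + scaled_digit R (Suc n) c"
  shows "b = c"
proof -
  obtain u v where "Rmat R n *v x = real_vec u" "Rmat R n *v y = real_vec v"
    using x by (auto simp: digit_lattice_def)
  then have "real_vec (R (Suc n) *v u + b) = real_vec (R (Suc n) *v v + c)"
    using eq by (metis Rmat_Suc_add_scaled_digit)
  then have uv: "R (Suc n) *v u + b = R (Suc n) *v v + c"
    by simp
  have "b + R (Suc n) *v w = c + R (Suc n) *v (w + (v - u))"
       "c + R (Suc n) *v w = b + R (Suc n) *v (w + (u - v))" for w
    using uv by (auto simp: algebra_simps)
  then have "{b + R (Suc n) *v v | v. True} = {c + R (Suc n) *v v | v. True}"
    by blast
  then show ?thesis
    using distinct_cosets[of "Suc n"] b unfolding distinct_cosets_def by (auto dest: inj_onD)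
qed

text \<open>If \<open>K\<close> bounds the operator norm of \<open>Rmat R n\<close>, lattice points
  closer than \<open>1 / K\<close> have integer images closer than 1. These images agree, and
  injectivity finishes.\<close>

lemma lattice_discrete: "\<exists>r>0. \<forall>x\<in>digit_lattice R n. \<forall>y\<in>digit_lattice R n. dist x y < r \<longrightarrow> x = y"
proof -
  obtain K where K: "K > 0" "\<And>x. norm (Rmat R n *v x) \<le> norm x * K"
    using bounded_linear.pos_bounded[OF matrix_vector_mul_bounded_linear] by blast
  have "x = y" if x: "x \<in> digit_lattice R n" "y \<in> digit_lattice R n" and d: "dist x y < 1 / K" for x y
  proof -
    obtain w where w: "Rmat R n *v (x - y) = real_vec w"
      using x by (auto simp: digit_lattice_def matrix_vector_mult_diff_distrib simp flip: real_vec_diff)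
    have "norm (real_vec w) \<le> norm (x - y) * K"
      using K(2)[of "x - y"] w by simp
    also have "\<dots> < 1"
      using d K(1) by (simp add: dist_norm field_simps)
    finally have "w = 0"
      by (rule real_vec_norm_less_1)
    with w have "Rmat R n *v (x - y) = 0"
      by simp
    then show "x = y"
      using invertible_Rmat[of R n, OF expanding]
      unfolding invertible_left_inverse matrix_left_invertible_ker by force
  qed
  then show ?thesis
    using K(1) by (intro exI[of _ "1 / K"]) auto
qed

lemma sets_partial_convolution [simp]: "sets (partial_convolution R B n) = sets borel"
  by (cases n) simp_all

lemma prob_space_digits: "prob_space (delta_set (digits (Suc n)))"
  by (intro prob_space_delta_set) (auto simp: finite_B B_nonempty)

lemma prob_space_partial_convolution: "prob_space (partial_convolution R B n)"
proof (induction n)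
  case (Suc n)
  then show ?case
    by (simp add: prob_space_convolution prob_space_digits)
qed (simp add: prob_space_return)

text \<open>By induction: translating an open set that misses the next lattice back by a digit gives
  an open set that misses the current one.\<close>

lemma partial_convolution_off_lattice:
  assumes "open U" "U \<inter> digit_lattice R n = {}"
  shows "emeasure (partial_convolution R B n) U = 0"
  using assms
proof (induction n arbitrary: U)
  case 0
  have "0 \<in> digit_lattice R 0"
    by (auto simp: digit_lattice_def intro!: image_eqI[of _ _ 0])
  then show ?case
    using 0 by (auto simp: indicator_def)
next
  case (Suc n)
  have "finite (digits (Suc n))" "digits (Suc n) \<noteq> {}"
    by (auto simp: finite_B B_nonempty)
  from AE_delta_set[OF this]
  have "AE x in delta_set (digits (Suc n)). emeasure (partial_convolution R B n) {a. a + x \<in> U} = 0"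
  proof eventually_elim
    fix x assume x: "x \<in> digits (Suc n)"
    have "open ((\<lambda>a. a + x) -` U)"
      using Suc.prems by (intro open_vimage continuous_intros)
    then show "emeasure (partial_convolution R B n) {a. a + x \<in> U} = 0"
      using x Suc.prems lattice_Suc by (intro Suc.IH) (auto simp: vimage_def)
  qed
  then show ?case
    using Suc.prems
    by (simp add: emeasure_convolution_left prob_space_digits prob_space_partial_convolution
        nn_integral_cong_AE)
qed

section \<open>Concentration bounds on small balls\<close>

definition digit_count :: "nat \<Rightarrow> nat" where
  "digit_count n = (\<Prod>k=1..n. card (B k))"

lemma card_B_pos: "j \<ge> 1 \<Longrightarrow> card (B j) > 0"
  using finite_B B_nonempty by (simp add: card_gt_0_iff)

lemma digit_count_pos: "digit_count n > 0"
  by (auto simp: digit_count_def intro!: prod_pos card_B_pos)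

text \<open>For a small radius at most one last digit lets the translated ball meet the previous
  lattice. Its probability contributes the factor \<open>1 / card (B (Suc n))\<close>, and the
  induction hypothesis bounds the rest.\<close>

lemma partial_convolution_ball_le:
  "\<exists>r>0. \<forall>x. emeasure (partial_convolution R B n) (ball x r) \<le> ennreal (1 / digit_count n)"
proof (induction n)
  case 0
  show ?case
    by (intro exI[of _ 1]) (auto simp: digit_count_def indicator_def)
next
  case (Suc n)
  let ?M = "partial_convolution R B n" and ?D = "digits (Suc n)"
  obtain r where r: "r > 0" "\<And>x. emeasure ?M (ball x r) \<le> ennreal (1 / digit_count n)"
    using Suc by blast
  obtain s where s: "s > 0" "\<And>x y. x \<in> digit_lattice R (Suc n) \<Longrightarrow> y \<in> digit_lattice R (Suc n) \<Longrightarrow> dist x y < s \<Longrightarrow> x = y"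
    using lattice_discrete by blast
  \<comment> \<open>The bound \<open>r\<close> serves the induction hypothesis; \<open>s / 2\<close>
    makes any two points of a ball of radius \<open>t\<close> closer than \<open>s\<close>.\<close>
  define t where "t = min r (s / 2)"
  have fin: "finite ?D" "?D \<noteq> {}"
    by (auto simp: finite_B B_nonempty)
  have [measurable]: "?D \<in> sets borel"
    using fin by (intro borel_closed finite_imp_closed)
  have "emeasure (partial_convolution R B (Suc n)) (ball x t) \<le> ennreal (1 / digit_count (Suc n))" for x
  proof -
    have shift: "{a. a + d \<in> ball x t} = ball (x - d) t" for d
      by (auto simp: dist_norm algebra_simps)
    have le: "emeasure ?M (ball (x - d) t) \<le> ennreal (1 / digit_count n)" for d
      by (rule order_trans[OF emeasure_mono r(2)]) (auto simp: t_def)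
    have uniq: "d = d'" if d: "d \<in> ?D" "d' \<in> ?D"
      and m: "ball (x - d) t \<inter> digit_lattice R n \<noteq> {}" "ball (x - d') t \<inter> digit_lattice R n \<noteq> {}" for d d'
    proof -
      obtain b b' where b: "b \<in> B (Suc n)" "b' \<in> B (Suc n)"
        and d_eq: "d = scaled_digit R (Suc n) b" "d' = scaled_digit R (Suc n) b'"
        using d by blast
      obtain p p' where p: "p \<in> digit_lattice R n" "p' \<in> digit_lattice R n" "dist (x - d) p < t" "dist (x - d') p' < t"
        using m by auto
      have "dist (p + d) (p' + d') < s"
        using p(3,4) norm_triangle_ineq4[of "x - d' - p'" "x - d - p"]
        by (simp add: t_def dist_norm algebra_simps)
      then have "p + d = p' + d'"
        using p(1,2) by (intro s(2)) (auto simp: d_eq intro: lattice_Suc)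
      then show ?thesis
        using lattice_Suc_inject[OF p(1,2) b] by (simp add: d_eq)
    qed
    \<comment> \<open>If no translated ball meets the lattice, any digit serves as
      \<open>d0\<close>.\<close>
    obtain d0 where d0: "d0 \<in> ?D" "\<And>d. d \<in> ?D \<Longrightarrow> d \<noteq> d0 \<Longrightarrow> ball (x - d) t \<inter> digit_lattice R n = {}"
      using uniq fin(2) by (metis ex_in_conv)
    have "emeasure (partial_convolution R B (Suc n)) (ball x t)
        = (\<integral>\<^sup>+d. emeasure ?M (ball (x - d) t) \<partial>delta_set ?D)"
      by (simp add: emeasure_convolution_left prob_space_digits prob_space_partial_convolution shift del: mem_ball)
    also have "\<dots> \<le> (\<integral>\<^sup>+d. ennreal (1 / digit_count n) * indicator {d0} d \<partial>delta_set ?D)"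
    proof (rule nn_integral_mono_AE)
      show "AE d in delta_set ?D. emeasure ?M (ball (x - d) t) \<le> ennreal (1 / digit_count n) * indicator {d0} d"
        using AE_delta_set[OF fin]
      proof eventually_elim
        case (elim d)
        then show ?case
          using le[of d] d0(2)[of d] by (cases "d = d0") (auto simp: partial_convolution_off_lattice)
      qed
    qed
    also have "\<dots> = ennreal (1 / digit_count n) * ennreal (1 / card (B (Suc n)))"
    proof -
      have "card ?D = card (B (Suc n))"
        by (intro card_image inj_onI) simp
      moreover have "?D \<inter> {d0} = {d0}" using d0 by blast
      ultimately show ?thesis
        using fin by (simp add: nn_integral_cmult_indicator emeasure_delta_set)
    qed
    also have "\<dots> = ennreal (1 / digit_count (Suc n))"
      by (subst ennreal_mult[symmetric]) (simp_all add: digit_count_def prod_nonneg)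
    finally show ?thesis .
  qed
  moreover have "t > 0" using r s by (simp add: t_def)
  ultimately show ?case by blast
qed

text \<open>Convolving with a probability measure averages ball masses over moved centres, so a
  bound uniform in the centre persists.\<close>

lemma later_partial_convolution_ball_le:
  assumes "m \<ge> n" and bound: "\<And>x. emeasure (partial_convolution R B n) (ball x r) \<le> c"
  shows "emeasure (partial_convolution R B m) (ball x r) \<le> c"
  using \<open>m \<ge> n\<close>
proof (induction m arbitrary: x rule: dec_induct)
  case (step m)
  interpret D: prob_space "delta_set (digits (Suc m))" by (rule prob_space_digits)
  have shift: "{a. a + d \<in> ball x r} = ball (x - d) r" for d
    by (auto simp: dist_norm algebra_simps)
  have "emeasure (partial_convolution R B (Suc m)) (ball x r)
      = (\<integral>\<^sup>+d. emeasure (partial_convolution R B m) (ball (x - d) r) \<partial>delta_set (digits (Suc m)))"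
    by (simp add: emeasure_convolution_left prob_space_digits prob_space_partial_convolution shift del: mem_ball)
  also have "\<dots> \<le> (\<integral>\<^sup>+d. c \<partial>delta_set (digits (Suc m)))"
    by (intro nn_integral_mono step.IH)
  also have "\<dots> = c" by (simp add: D.emeasure_space_1)
  finally show ?case .
qed (rule bound)

text \<open>Weak convergence is tested on a continuous function squeezed between the indicators of
  the point and of a small ball around it.\<close>

lemma measure_singleton_le:
  assumes "infinite_convolution R B \<mu>"
  shows "measure \<mu> {x} \<le> 1 / digit_count n"
proof -
  interpret \<mu>: prob_space \<mu> using assms by (simp add: infinite_convolution_def)
  have [measurable_cong]: "sets \<mu> = sets borel" using assms by (simp add: infinite_convolution_def)
  obtain r where r: "r > 0" "\<And>x. emeasure (partial_convolution R B n) (ball x r) \<le> ennreal (1 / digit_count n)"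
    using partial_convolution_ball_le by blast
  \<comment> \<open>A tent of height 1 at \<open>x\<close> that vanishes outside the ball of radius
    \<open>r\<close>.\<close>
  define f where "f y = max 0 (1 - dist x y / r)" for y
  have f_cont: "continuous_on UNIV f"
    unfolding f_def by (intro continuous_intros) (use r in auto)
  then have [measurable]: "f \<in> borel_measurable borel" by (rule borel_measurable_continuous_onI)
  have f01: "0 \<le> f y" "f y \<le> 1" for y
    using r by (auto simp: f_def)
  have "measure \<mu> {x} = (\<integral>y. indicator {x} y \<partial>\<mu>)" by simp
  also have "\<dots> \<le> (\<integral>y. f y \<partial>\<mu>)"
    using f01
    by (intro integral_mono \<mu>.integrable_const_bound[where B = 1])
       (auto simp: indicator_def f_def split: if_splits)
  also have "\<dots> \<le> 1 / digit_count n"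
  proof (rule LIMSEQ_le_const2)
    have "bounded (range f)"
      using f01 by (intro boundedI[of _ 1]) auto
    then show "(\<lambda>m. \<integral>y. f y \<partial>partial_convolution R B m) \<longlonglongrightarrow> (\<integral>y. f y \<partial>\<mu>)"
      using assms f_cont by (simp add: infinite_convolution_def weakly_converges_def)
    show "\<exists>N. \<forall>m\<ge>N. (\<integral>y. f y \<partial>partial_convolution R B m) \<le> 1 / digit_count n"
    proof (intro exI allI impI)
      fix m assume m: "m \<ge> n"
      interpret M: prob_space "partial_convolution R B m" by (rule prob_space_partial_convolution)
      have [measurable_cong]: "sets (partial_convolution R B m) = sets borel" by simp
      have "(\<integral>y. f y \<partial>partial_convolution R B m) \<le> (\<integral>y. indicator (ball x r) y \<partial>partial_convolution R B m)"
        using r f01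
        by (intro integral_mono M.integrable_const_bound[where B = 1])
           (auto simp: indicator_def f_def field_simps)
      also have "\<dots> = measure (partial_convolution R B m) (ball x r)"
        by simp
      also have "\<dots> \<le> 1 / digit_count n"
        using later_partial_convolution_ball_le[OF m r(2)]
        by (simp add: M.emeasure_eq_measure)
      finally show "(\<integral>y. f y \<partial>partial_convolution R B m) \<le> 1 / digit_count n" .
    qed
  qed
  finally show ?thesis .
qed

section \<open>Growth of the number of digit strings and absence of atoms\<close>

lemma digit_count_mono: "m \<le> n \<Longrightarrow> digit_count m \<le> digit_count n"
  unfolding digit_count_def
  by (intro dvd_imp_le prod_dvd_prod_subset prod_pos) (auto intro: card_B_pos)

lemma digit_count_unbounded:
  assumes "infinite {j. j \<ge> 1 \<and> card (B j) \<ge> 2}"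
  shows "\<exists>n. digit_count n \<ge> 2 ^ k"
proof (induction k)
  case 0
  show ?case using digit_count_pos[of 0] by (intro exI[of _ 0]) simp
next
  case (Suc k)
  then obtain n where n: "digit_count n \<ge> 2 ^ k" by blast
  \<comment> \<open>The next index with at least two digits at least doubles the count; the indices
    in between cannot decrease it.\<close>
  obtain j where j: "j > n" "card (B j) \<ge> 2"
    using assms unfolding infinite_nat_iff_unbounded by blast
  then obtain i where i: "j = Suc i" "i \<ge> n" by (cases j) auto
  have "2 ^ Suc k \<le> digit_count i * card (B (Suc i))"
    using mult_mono[of "2 ^ k" "digit_count i" 2 "card (B j)"] n digit_count_mono[OF i(2)] j i
    by (simp add: mult.commute)
  also have "\<dots> = digit_count (Suc i)"
    by (simp add: digit_count_def)
  finally show ?case by blast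
qed

theorem infinite_convolution_atomless:
  assumes "infinite_convolution R B \<mu>" "infinite {j. j \<ge> 1 \<and> card (B j) \<ge> 2}"
  shows "measure \<mu> {x} = 0"
proof -
  have "measure \<mu> {x} \<le> (1 / 2) ^ k" for k
  proof -
    obtain n where n: "digit_count n \<ge> 2 ^ k"
      using digit_count_unbounded[OF assms(2)] by blast
    then have "real (digit_count n) \<ge> 2 ^ k"
      by (metis of_nat_le_iff of_nat_numeral of_nat_power)
    then have "1 / digit_count n \<le> (1 / 2) ^ k"
      by (simp add: power_one_over frac_le)
    then show ?thesis
      using measure_singleton_le[OF assms(1), of x n] by linarith
  qed
  moreover have "(\<lambda>k. (1 / 2 :: real) ^ k) \<longlonglongrightarrow> 0"
    by (rule LIMSEQ_realpow_zero) auto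
  ultimately have "measure \<mu> {x} \<le> 0"
    by (intro LIMSEQ_le_const) auto
  then show ?thesis
    by (simp add: measure_le_0_iff)
qed

end

text \<open>Requiring infinitely many digit sets with at least two elements excludes measures of
  finite support, whose \<open>L^2\<close> space is finite-dimensional and so has no infinite Riesz
  sequence.\<close>

theorem theorem5p4:
  fixes R :: "nat \<Rightarrow> int ^ 'n ^ 'n"
    and B :: "nat \<Rightarrow> (int ^ 'n) set"
    and \<mu> :: "(real ^ 'n) measure"
  assumes "\<And>j. j \<ge> 1 \<Longrightarrow> expanding (R j)"
    and "\<And>j. j \<ge> 1 \<Longrightarrow> finite (B j) \<and> B j \<noteq> {}"
    and "\<And>j. j \<ge> 1 \<Longrightarrow> distinct_cosets (R j) (B j)"
    and "infinite {j. j \<ge> 1 \<and> card (B j) \<ge> 2}"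
    and "infinite_convolution R B \<mu>"
    and "digit_series_converge R B"
    and "no_overlap R B \<mu>"
  shows "\<exists>\<Lambda> :: (real ^ 'n) set. infinite \<Lambda> \<and> Riesz_sequence_L2 \<mu> \<Lambda> expo"
proof -
  interpret expanding_digits R B
    using assms(1-3) by unfold_locales auto
  show ?thesis
    using assms(5) infinite_convolution_atomless[OF assms(5,4)]
    by (intro atomless_imp_exponential_Riesz_sequence) (auto simp: infinite_convolution_def)
qed

end
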